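(* Let $(G,\alpha,\beta,\mu,\iota;G_0)$ be a groupoid of type $(4;2)$, i.e. a groupoid with $|G|=4$ and $|G_0|=2$. Then $G$ is isomorphic (as a groupoid) to one of the following groupoids: (i) $\{e\}\coprod \mathbf{Z}_3$; (ii) $\mathbf{Z}_2\coprod \mathbf{Z}_2$; (iii) $\mathcal{F}_{(4;2)}(\mathbf{R}^2)$, the groupoid of saltus functions defined on the axes of coordinates in a plane.
   Context: **Groupoid (in the sense of Brandt).** Let $G$ be a nonempty set and $G_0\subseteq G$ a nonempty subset, with surjections $\alpha,\beta:G\to G_0$ (source and target) and a partial multiplication $\mu:G_{(2)}\to G$, $(x,y)\mapsto \mu(x,y)=xy$, where $G_{(2)}=\{(x,y)\in G\times G \mid \beta(x)=\alpha(y)\}$ is the set of composable pairs. - $(G,\alpha,\beta,\mu;G_0)$ is a *semigroupoid* if $\mu$ is associative: $(xy)z=x(yz)$, in the sense that if one side is defined then so is the other and they are equal (the element $(xy)z$ is defined iff $\beta(x)=\alpha(y)$ and $\beta(y)=\alpha(z)$). - A semigroupoid is a *monoidoid* if for each $x\in G$ we have $(\alpha(x),x),(x,\beta(x))\in G_{(2)}$ and $\alpha(x)x=x\beta(x)=x$. - A monoidoid together with an injective map $\iota:G\to G$, $x\mapsto x^{-1}$, is a *groupoid* $(G,\alpha,\beta,\mu,\iota;G_0)$ if for each $x\in G$ we have $(x^{-1},x),(x,x^{-1})\in G_{(2)}$, $x^{-1}x=\beta(x)$ and $xx^{-1}=\alpha(x)$. $G_0$ is the unit set. (Equivalently, a groupoid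 is a small category in which all morphisms are invertible, where $G$ is the set of morphisms and $G_0$ the set of identity morphisms.) A groupoid is of type $(n;m)$ if $|G|=n$ and $|G_0|=m$. **Morphisms.** A groupoid morphism $f:G\to G'$ is a map such that $f(\mu(x,y))=\mu'(f(x),f(y))$ for all $(x,y)\in G_{(2)}$ (in particular $(f(x),f(y))$ is composable in $G'$). An isomorphism of groupoids is a bijective groupoid morphism. **Groups and disjoint unions.** A group with identity $e$ is regarded as a groupoid with unit set $\{e\}$, $\alpha$ and $\beta$ constant equal to $e$, the group multiplication, and group inversion. For groups $G_1,G_2$ with identities $e_1,e_2$ (replaced by the disjoint copies $G_i\times\{i\}$ if they are not disjoint), $G_1\coprod G_2$ is the groupoid on $G_1\cup G_2$ with unit set $\{e_1,e_2\}$, where $\alpha(x)=\beta(x)=e_i$ for $x\in G_i$, two elements are composable iff they lie in the same $G_i$, and then the product and the inverses are those of $G_i$. Here $\{e\}$ is the trivial group and $\mathbf{Z}_n$ is the additive group of integers modulo $n$. **The groupoid $\mathcal{F}_{(4;2)}(\mathbf{R}^2)$.** Let $Ox=\{(x,0)\mid x\in\mathbf{R}\}$ and $Oy=\{(0,y)\mid y\in\mathbf{R}\}$ be the coordinate axes in $\mathbf{R}^2$. The underlying set is $\{f_1,f_2,f_3,f_4\}$ with $f_1=\mathrm{Id}_{Ox}$, $f_2=\mathrm{Id}_{Oy}$, $f_3:Ox\to Oy$, $f_3(x,0)=(0,x)$, and $f_4:Oy\to Ox$, $f_4(0,y)=(y,0)$. The unit set is $\{f_1,f_2\}$; $\alpha(f)$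 is the identity map of the domain of $f$ and $\beta(f)$ is the identity map of the image of $f$, so that $\alpha(f_1)=\beta(f_1)=f_1$, $\alpha(f_2)=\beta(f_2)=f_2$, $\alpha(f_3)=\beta(f_4)=f_1$, $\alpha(f_4)=\beta(f_3)=f_2$. For composable pairs $\mu(f,g)=g\circ f$. The inversion is $\iota(f_1)=f_1$, $\iota(f_2)=f_2$, $\iota(f_3)=f_4$, $\iota(f_4)=f_3$. *)

theory Defs
  imports Complex_Main "HOL-Algebra.Elementary_Groups"
begin

section \<open>Groupoids in the sense of Brandt\<close>

text \<open>
  The operations are total functions on the element type. Only their values on the carrier,
  and for the multiplication only those on composable pairs, are meaningful.
\<close>

record 'a groupoid_struct = "'a partial_object" +
  unit_set :: "'a set"
  source :: "'a \<Rightarrow> 'a"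
  target :: "'a \<Rightarrow> 'a"
  pmult :: "'a \<Rightarrow> 'a \<Rightarrow> 'a"
  ginv :: "'a \<Rightarrow> 'a"

definition composable :: "('a, 'm) groupoid_struct_scheme \<Rightarrow> ('a \<times> 'a) set" where
  "composable G = {(x, y). x \<in> carrier G \<and> y \<in> carrier G \<and> target G x = source G y}"

text \<open>
  \<open>(xy)z\<close> is defined iff \<open>(x, y)\<close> and \<open>(xy, z)\<close> are composable, and \<open>x(yz)\<close> is defined iff
  \<open>(y, z)\<close> and \<open>(x, yz)\<close> are. Associativity demands that both conditions coincide with
  the composability of \<open>(x, y)\<close> and \<open>(y, z)\<close>, and that the two products then agree.
\<close>

locale semigroupoid =
  fixes G :: "('a, 'm) groupoid_struct_scheme"
  assumes carrier_nonempty: "carrier G \<noteq> {}"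
    and units_nonempty: "unit_set G \<noteq> {}"
    and units_subset: "unit_set G \<subseteq> carrier G"
    and source_surj: "source G ` carrier G = unit_set G"
    and target_surj: "target G ` carrier G = unit_set G"
    and pmult_closed: "(x, y) \<in> composable G \<Longrightarrow> pmult G x y \<in> carrier G"
    and assoc_left_defined:
      "\<lbrakk>x \<in> carrier G; y \<in> carrier G; z \<in> carrier G\<rbrakk> \<Longrightarrow>
        (x, y) \<in> composable G \<and> (pmult G x y, z) \<in> composable G \<longleftrightarrow>
        (x, y) \<in> composable G \<and> (y, z) \<in> composable G"
    and assoc_right_defined:
      "\<lbrakk>x \<in> carrier G; y \<in> carrier G; z \<in> carrier G\<rbrakk> \<Longrightarrow>
        (y, z) \<in> composable G \<and> (x, pmult G y z) \<in> composable G \<longleftrightarrow>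
        (x, y) \<in> composable G \<and> (y, z) \<in> composable G"
    and assoc:
      "\<lbrakk>(x, y) \<in> composable G; (y, z) \<in> composable G\<rbrakk> \<Longrightarrow>
        pmult G (pmult G x y) z = pmult G x (pmult G y z)"

locale monoidoid = semigroupoid +
  assumes source_composable: "x \<in> carrier G \<Longrightarrow> (source G x, x) \<in> composable G"
    and target_composable: "x \<in> carrier G \<Longrightarrow> (x, target G x) \<in> composable G"
    and source_unit: "x \<in> carrier G \<Longrightarrow> pmult G (source G x) x = x"
    and target_unit: "x \<in> carrier G \<Longrightarrow> pmult G x (target G x) = x"

locale groupoid = monoidoid +
  assumes ginv_closed: "x \<in> carrier G \<Longrightarrow> ginv G x \<in> carrier G"
    and ginv_inj: "inj_on (ginv G) (carrier G)"
    and ginv_composable_left: "x \<in> carrier G \<Longrightarrow> (ginv G x, x) \<in> composable G"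
    and ginv_composable_right: "x \<in> carrier G \<Longrightarrow> (x, ginv G x) \<in> composable G"
    and ginv_left: "x \<in> carrier G \<Longrightarrow> pmult G (ginv G x) x = target G x"
    and ginv_right: "x \<in> carrier G \<Longrightarrow> pmult G x (ginv G x) = source G x"

definition groupoid_of_type :: "('a, 'm) groupoid_struct_scheme \<Rightarrow> nat \<Rightarrow> nat \<Rightarrow> bool" where
  "groupoid_of_type G n m \<longleftrightarrow>
     groupoid G \<and> finite (carrier G) \<and> card (carrier G) = n \<and> card (unit_set G) = m"

definition groupoid_hom ::
  "('a, 'm) groupoid_struct_scheme \<Rightarrow> ('b, 'n) groupoid_struct_scheme \<Rightarrow> ('a \<Rightarrow> 'b) set" where
  "groupoid_hom G H = {h. h \<in> carrier G \<rightarrow> carrier H \<and>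
     (\<forall>(x, y) \<in> composable G.
        (h x, h y) \<in> composable H \<and> h (pmult G x y) = pmult H (h x) (h y))}"

definition groupoid_isomorphic ::
  "('a, 'm) groupoid_struct_scheme \<Rightarrow> ('b, 'n) groupoid_struct_scheme \<Rightarrow> bool" where
  "groupoid_isomorphic G H \<longleftrightarrow>
     (\<exists>h \<in> groupoid_hom G H. bij_betw h (carrier G) (carrier H))"


section \<open>Disjoint union of two groups\<close>

text \<open>The sum type provides the disjoint copies of the two groups.\<close>

definition group_coproduct ::
  "('a, 'm) monoid_scheme \<Rightarrow> ('b, 'n) monoid_scheme \<Rightarrow> ('a + 'b) groupoid_struct" where
  "group_coproduct G H =
     \<lparr>carrier = carrier G <+> carrier H,
      unit_set = {Inl \<one>\<^bsub>G\<^esub>, Inr \<one>\<^bsub>H\<^esub>},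
      source = case_sum (\<lambda>_. Inl \<one>\<^bsub>G\<^esub>) (\<lambda>_. Inr \<one>\<^bsub>H\<^esub>),
      target = case_sum (\<lambda>_. Inl \<one>\<^bsub>G\<^esub>) (\<lambda>_. Inr \<one>\<^bsub>H\<^esub>),
      pmult = (\<lambda>x y. case (x, y) of
          (Inl a, Inl b) \<Rightarrow> Inl (a \<otimes>\<^bsub>G\<^esub> b)
        | (Inr a, Inr b) \<Rightarrow> Inr (a \<otimes>\<^bsub>H\<^esub> b)
        | _ \<Rightarrow> undefined),
      ginv = map_sum (m_inv G) (m_inv H)\<rparr>"

lemma groupoid_group_coproduct:
  assumes "group G" "group H"
  shows "groupoid (group_coproduct G H)"
proof -
  interpret G: group G by fact
  interpret H: group H by fact
  let ?K = "group_coproduct G H"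
  have carr: "carrier ?K = carrier G <+> carrier H"
    and units: "unit_set ?K = {Inl \<one>\<^bsub>G\<^esub>, Inr \<one>\<^bsub>H\<^esub>}"
    and src: "source ?K (Inl a) = Inl \<one>\<^bsub>G\<^esub>" "source ?K (Inr b) = Inr \<one>\<^bsub>H\<^esub>"
    and tgt: "target ?K (Inl a) = Inl \<one>\<^bsub>G\<^esub>" "target ?K (Inr b) = Inr \<one>\<^bsub>H\<^esub>"
    and mul: "pmult ?K (Inl a) (Inl a') = Inl (a \<otimes>\<^bsub>G\<^esub> a')"
      "pmult ?K (Inr b) (Inr b') = Inr (b \<otimes>\<^bsub>H\<^esub> b')"
    and ginv: "ginv ?K (Inl a) = Inl (inv\<^bsub>G\<^esub> a)" "ginv ?K (Inr b) = Inr (inv\<^bsub>H\<^esub> b)"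
    for a a' b b'
    by (simp_all add: group_coproduct_def)
  have comp: "(x, y) \<in> composable ?K \<longleftrightarrow>
      (\<exists>a\<in>carrier G. \<exists>a'\<in>carrier G. x = Inl a \<and> y = Inl a') \<or>
      (\<exists>b\<in>carrier H. \<exists>b'\<in>carrier H. x = Inr b \<and> y = Inr b')" for x y
    by (cases x; cases y) (auto simp: composable_def carr src tgt)
  have srctgt: "source ?K = target ?K"
    by (simp add: group_coproduct_def)
  have img: "target ?K ` carrier ?K = unit_set ?K"
  proof (rule equalityI)
    show "target ?K ` carrier ?K \<subseteq> unit_set ?K"
      by (auto simp: carr units tgt)
    have "Inl \<one>\<^bsub>G\<^esub> \<in> target ?K ` carrier ?K" "Inr \<one>\<^bsub>H\<^esub> \<in> target ?K ` carrier ?K"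
      using imageI[of "Inl \<one>\<^bsub>G\<^esub>" "carrier ?K" "target ?K"]
        imageI[of "Inr \<one>\<^bsub>H\<^esub>" "carrier ?K" "target ?K"]
      by (simp_all add: carr tgt InlI InrI)
    then show "unit_set ?K \<subseteq> target ?K ` carrier ?K"
      by (simp add: units)
  qed
  show ?thesis
  proof unfold_locales
    show "carrier ?K \<noteq> {}" "unit_set ?K \<noteq> {}" "unit_set ?K \<subseteq> carrier ?K"
      by (auto simp: carr units)
    show "source ?K ` carrier ?K = unit_set ?K" "target ?K ` carrier ?K = unit_set ?K"
      using img srctgt by simp_all
    show "inj_on (ginv ?K) (carrier ?K)"
    proof (rule inj_onI)
      fix x y
      assume "x \<in> carrier ?K" "y \<in> carrier ?K" "ginv ?K x = ginv ?K y"
      then show "x = y"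
        by (cases x; cases y)
          (auto simp: carr ginv inj_on_eq_iff[OF G.inv_inj] inj_on_eq_iff[OF H.inv_inj])
    qed
  qed (auto simp: comp carr src tgt mul ginv G.m_assoc H.m_assoc)
qed


section \<open>The groupoid of saltus functions on the coordinate axes\<close>

text \<open>
  A function between subsets of the plane is a partial map whose domain is the source set;
  each of the four functions below is onto its codomain, which is therefore its range.
\<close>

definition axis_x :: "(real \<times> real) set" where
  "axis_x = {(x, 0) |x. True}"

definition axis_y :: "(real \<times> real) set" where
  "axis_y = {(0, y) |y. True}"

definition id_map :: "'a set \<Rightarrow> 'a \<rightharpoonup> 'a" where
  "id_map A = Some |` A"

definition saltus1 :: "real \<times> real \<rightharpoonup> real \<times> real" where
  "saltus1 = id_map axis_x"

definition saltus2 :: "real \<times> real \<rightharpoonup> real \<times> real" where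
  "saltus2 = id_map axis_y"

definition saltus3 :: "real \<times> real \<rightharpoonup> real \<times> real" where
  "saltus3 = (\<lambda>(x, y). Some (0, x)) |` axis_x"

definition saltus4 :: "real \<times> real \<rightharpoonup> real \<times> real" where
  "saltus4 = (\<lambda>(x, y). Some (y, 0)) |` axis_y"

definition saltus_groupoid :: "(real \<times> real \<rightharpoonup> real \<times> real) groupoid_struct" where
  "saltus_groupoid =
     \<lparr>carrier = {saltus1, saltus2, saltus3, saltus4},
      unit_set = {saltus1, saltus2},
      source = (\<lambda>f. id_map (dom f)),
      target = (\<lambda>f. id_map (ran f)),
      pmult = (\<lambda>f g. g \<circ>\<^sub>m f),
      ginv = (\<lambda>f. if f = saltus3 then saltus4 else if f = saltus4 then saltus3 else f)\<rparr>"

lemma dom_ran_id_map [simp]: "dom (id_map A) = A" "ran (id_map A) = A"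
  by (auto simp: id_map_def ran_def restrict_map_def split: if_splits)

lemma id_map_eq_iff [simp]: "id_map A = id_map B \<longleftrightarrow> A = B"
  by (metis dom_ran_id_map(1))

lemma dom_ran_saltus:
  "dom saltus1 = axis_x" "ran saltus1 = axis_x"
  "dom saltus2 = axis_y" "ran saltus2 = axis_y"
  "dom saltus3 = axis_x" "ran saltus3 = axis_y"
  "dom saltus4 = axis_y" "ran saltus4 = axis_x"
  by (auto simp: saltus1_def saltus2_def saltus3_def saltus4_def id_map_def axis_x_def axis_y_def
      ran_def restrict_map_def dom_def split: if_splits)

lemma axes_neq: "axis_x \<noteq> axis_y"
proof -
  have "(1, 0) \<in> axis_x" "(1, 0) \<notin> axis_y"
    by (auto simp: axis_x_def axis_y_def)
  then show ?thesis by metis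
qed

lemma saltus_distinct: "distinct [saltus1, saltus2, saltus3, saltus4]"
  using axes_neq dom_ran_saltus by (simp; metis)

lemma saltus_source_target:
  "source saltus_groupoid saltus1 = saltus1" "target saltus_groupoid saltus1 = saltus1"
  "source saltus_groupoid saltus2 = saltus2" "target saltus_groupoid saltus2 = saltus2"
  "source saltus_groupoid saltus3 = saltus1" "target saltus_groupoid saltus3 = saltus2"
  "source saltus_groupoid saltus4 = saltus2" "target saltus_groupoid saltus4 = saltus1"
  by (simp_all add: saltus_groupoid_def dom_ran_saltus saltus1_def saltus2_def)

lemma saltus_ginv:
  "ginv saltus_groupoid saltus1 = saltus1" "ginv saltus_groupoid saltus2 = saltus2"
  "ginv saltus_groupoid saltus3 = saltus4" "ginv saltus_groupoid saltus4 = saltus3"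
  using saltus_distinct by (auto simp: saltus_groupoid_def)

lemma saltus_pmult:
  "pmult saltus_groupoid saltus1 saltus1 = saltus1"
  "pmult saltus_groupoid saltus1 saltus3 = saltus3"
  "pmult saltus_groupoid saltus2 saltus2 = saltus2"
  "pmult saltus_groupoid saltus2 saltus4 = saltus4"
  "pmult saltus_groupoid saltus3 saltus2 = saltus3"
  "pmult saltus_groupoid saltus3 saltus4 = saltus1"
  "pmult saltus_groupoid saltus4 saltus1 = saltus4"
  "pmult saltus_groupoid saltus4 saltus3 = saltus2"
  by (auto simp: saltus_groupoid_def saltus1_def saltus2_def saltus3_def saltus4_def
      id_map_def axis_x_def axis_y_def restrict_map_def map_comp_def fun_eq_iff)

lemma saltus_composable:
  "composable saltus_groupoid =
     {(saltus1, saltus1), (saltus1, saltus3), (saltus2, saltus2), (saltus2, saltus4),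
      (saltus3, saltus2), (saltus3, saltus4), (saltus4, saltus1), (saltus4, saltus3)}"
proof -
  have "carrier saltus_groupoid = {saltus1, saltus2, saltus3, saltus4}"
    by (simp add: saltus_groupoid_def)
  then show ?thesis
    using saltus_distinct by (auto simp: composable_def saltus_source_target)
qed

lemma groupoid_saltus_groupoid: "groupoid saltus_groupoid"
proof -
  let ?S = "saltus_groupoid"
  have carr: "carrier ?S = {saltus1, saltus2, saltus3, saltus4}"
    and units: "unit_set ?S = {saltus1, saltus2}"
    by (simp_all add: saltus_groupoid_def)
  have cases: P if "x \<in> carrier ?S" "x = saltus1 \<Longrightarrow> P" "x = saltus2 \<Longrightarrow> P"
      "x = saltus3 \<Longrightarrow> P" "x = saltus4 \<Longrightarrow> P" for x P
    using that carr by blast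
  have neq: "saltus1 \<noteq> saltus2" "saltus1 \<noteq> saltus3" "saltus1 \<noteq> saltus4"
      "saltus2 \<noteq> saltus3" "saltus2 \<noteq> saltus4" "saltus3 \<noteq> saltus4"
    using saltus_distinct by simp_all
  note neqs = neq neq[symmetric]
  have comp: "(x, y) \<in> composable ?S \<longleftrightarrow>
      x \<in> carrier ?S \<and> y \<in> carrier ?S \<and> target ?S x = source ?S y" for x y
    by (simp add: composable_def)
  have mem: "saltus1 \<in> carrier ?S" "saltus2 \<in> carrier ?S"
      "saltus3 \<in> carrier ?S" "saltus4 \<in> carrier ?S"
    by (simp_all add: carr)
  note facts = comp mem neqs saltus_source_target saltus_pmult saltus_ginv
  show ?thesis
  proof unfold_locales
    show "carrier ?S \<noteq> {}" "unit_set ?S \<noteq> {}" "unit_set ?S \<subseteq> carrier ?S"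
      by (simp_all add: carr units)
    show "source ?S ` carrier ?S = unit_set ?S"
      by (simp add: carr units saltus_source_target insert_commute)
    show "target ?S ` carrier ?S = unit_set ?S"
      by (simp add: carr units saltus_source_target insert_commute)
    show "pmult ?S x y \<in> carrier ?S" if "(x, y) \<in> composable ?S" for x y
    proof -
      have "x \<in> carrier ?S" "y \<in> carrier ?S" using that by (simp_all add: comp)
      then show ?thesis using that
        by (elim cases; simp add: facts)
    qed
  next
    fix x y z
    assume "x \<in> carrier ?S" "y \<in> carrier ?S" "z \<in> carrier ?S"
    then show "((x, y) \<in> composable ?S \<and> (pmult ?S x y, z) \<in> composable ?S) =
        ((x, y) \<in> composable ?S \<and> (y, z) \<in> composable ?S)"
      by (elim cases; simp add: facts)
  next
    fix x y z
    assume "x \<in> carrier ?S" "y \<in> carrier ?S" "z \<in> carrier ?S"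
    then show "((y, z) \<in> composable ?S \<and> (x, pmult ?S y z) \<in> composable ?S) =
        ((x, y) \<in> composable ?S \<and> (y, z) \<in> composable ?S)"
      by (elim cases; simp add: facts)
  next
    fix x y z
    assume *: "(x, y) \<in> composable ?S" "(y, z) \<in> composable ?S"
    then have "x \<in> carrier ?S" "y \<in> carrier ?S" "z \<in> carrier ?S"
      by (simp_all add: comp)
    then show "pmult ?S (pmult ?S x y) z = pmult ?S x (pmult ?S y z)"
      using * by (elim cases; simp add: facts)
  next
    show "inj_on (ginv ?S) (carrier ?S)"
      by (simp add: carr saltus_ginv neqs)
  qed (elim cases; simp add: facts)+
qed

lemma groupoid_of_type_coproduct_1_3:
  "groupoid_of_type (group_coproduct (singleton_group ()) (integer_mod_group 3)) 4 2"
  by (auto simp: groupoid_of_type_def groupoid_group_coproduct)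
    (simp_all add: group_coproduct_def carrier_integer_mod_group card_Plus)

lemma groupoid_of_type_coproduct_2_2:
  "groupoid_of_type (group_coproduct (integer_mod_group 2) (integer_mod_group 2)) 4 2"
  by (auto simp: groupoid_of_type_def groupoid_group_coproduct)
    (simp_all add: group_coproduct_def carrier_integer_mod_group card_Plus)

lemma groupoid_of_type_saltus_groupoid: "groupoid_of_type saltus_groupoid 4 2"
  using saltus_distinct groupoid_saltus_groupoid
  by (simp add: groupoid_of_type_def saltus_groupoid_def)

end

theory Submission
  imports Defs "HOL-Algebra.Multiplicative_Group" "HOL-Computational_Algebra.Primes"
begin

text \<open>
  The classification splits on whether some arrow joins the two units \<open>u\<close> and \<open>v\<close>.

  If an arrow \<open>x\<close> has different source and target, then \<open>x\<close>, its inverse and the two units are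
  pairwise distinct, as their pairs (source, target) are the four elements of \<open>{u, v} \<times> {u, v}\<close>.
  They exhaust the four elements, and the axioms force every product, so that only the groupoid
  of saltus functions is possible (\<open>isomorphic_saltus_groupoid\<close>).

  Otherwise every arrow is a loop, and the groupoid is the disjoint union of its isotropy groups
  at \<open>u\<close> and \<open>v\<close> (\<open>isomorphic_group_coproduct\<close>). The orders of the two groups are positive
  and add up to \<open>4\<close>, so up to exchanging the units they are \<open>1, 3\<close> or \<open>2, 2\<close>. A group of prime
  order is cyclic (\<open>prime_order_iso_integer_mod_group\<close>), which leaves the two coproducts.
\<close>

section \<open>Groups of order one and of prime order\<close>

lemma (in group) order_1_iso_singleton_group:
  assumes "card (carrier G) = 1"
  shows "G \<cong> singleton_group c"
proof -
  have "carrier G = {\<one>}"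
    using assms one_closed by (metis card_1_singletonE singletonD)
  then have "(\<lambda>_. c) \<in> iso G (singleton_group c)"
    by (auto intro!: isoI homI simp: bij_betw_def singleton_group_def)
  then show ?thesis
    by (rule is_isoI)
qed

text \<open>
  By Lagrange, an element \<open>x \<noteq> \<one>\<close> has order \<open>p\<close>. Hence \<open>i \<mapsto> x\<^sup>i\<close> depends only on \<open>i\<close> modulo \<open>p\<close>
  and is an injective homomorphism between sets of the same size.
\<close>

lemma (in group) prime_order_iso_integer_mod_group:
  assumes "prime p" and card: "card (carrier G) = p"
  shows "G \<cong> integer_mod_group p"
proof -
  have p: "p > 1"
    using \<open>prime p\<close> prime_gt_1_nat by blast
  then have fin: "finite (carrier G)"
    using card card_ge_0_finite by force
  obtain x where x: "x \<in> carrier G" "x \<noteq> \<one>"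
    using p card card_le_Suc0_iff_eq[OF fin] one_closed
    by (metis One_nat_def leD)
  have "ord x dvd p"
    using ord_dvd_group_order[OF x(1)] card by (simp add: order_def)
  moreover have "ord x \<noteq> 1"
    using ord_eq_1[OF x(1)] x(2) by simp
  ultimately have ord: "ord x = p"
    using \<open>prime p\<close> by (auto simp: prime_nat_iff)
  let ?Z = "integer_mod_group p"
  let ?f = "\<lambda>i::int. x [^] i"
  have carr: "carrier ?Z = {0..<int p}"
    using p by (simp add: carrier_integer_mod_group)
  have hom: "?f \<in> hom ?Z G"
  proof (rule homI)
    fix i j
    have "int p dvd (i + j) - (i + j) mod int p"
      by (rule dvd_minus_mod)
    then have "x [^] ((i + j) mod int p) = x [^] (i + j)"
      by (simp add: int_pow_eq x ord)
    then show "x [^] (i \<otimes>\<^bsub>?Z\<^esub> j) = x [^] i \<otimes> x [^] j"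
      by (simp add: int_pow_mult x)
  qed (simp add: x)
  have inj: "inj_on ?f (carrier ?Z)"
  proof (rule inj_onI)
    fix i j
    assume "i \<in> carrier ?Z" "j \<in> carrier ?Z" "x [^] i = x [^] j"
    then have "int p dvd j - i" "i mod int p = i" "j mod int p = j"
      by (simp_all add: int_pow_eq x ord carr)
    then show "i = j"
      by (metis mod_eq_dvd_iff)
  qed
  have "?f ` carrier ?Z = carrier G"
  proof (rule card_subset_eq[OF fin])
    show "?f ` carrier ?Z \<subseteq> carrier G"
      by (auto simp: x)
    show "card (?f ` carrier ?Z) = card (carrier G)"
      using card_image[OF inj] by (simp add: card carr)
  qed
  with hom inj have "?f \<in> iso ?Z G"
    by (simp add: iso_def bij_betw_def)
  then have "?Z \<cong> G"
    by (rule is_isoI)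
  then show ?thesis
    by (rule group.iso_sym[OF group_integer_mod_group])
qed

section \<open>Isotropy groups\<close>

definition isotropy_group :: "('a, 'm) groupoid_struct_scheme \<Rightarrow> 'a \<Rightarrow> 'a monoid" where
  "isotropy_group G a =
     \<lparr>carrier = {x \<in> carrier G. source G x = a \<and> target G x = a},
      monoid.mult = pmult G, one = a\<rparr>"

lemma isotropy_group_simps:
  "carrier (isotropy_group G a) = {x \<in> carrier G. source G x = a \<and> target G x = a}"
  "monoid.mult (isotropy_group G a) = pmult G"
  "one (isotropy_group G a) = a"
  by (simp_all add: isotropy_group_def)

context groupoid
begin

lemma composable_iff:
  "(x, y) \<in> composable G \<longleftrightarrow> x \<in> carrier G \<and> y \<in> carrier G \<and> target G x = source G y"
  by (simp add: composable_def)

lemma source_in_units: "x \<in> carrier G \<Longrightarrow> source G x \<in> unit_set G"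
  using source_surj by blast

lemma target_in_units: "x \<in> carrier G \<Longrightarrow> target G x \<in> unit_set G"
  using target_surj by blast

lemma source_of_unit:
  assumes "a \<in> unit_set G"
  shows "source G a = a"
proof -
  obtain x where "x \<in> carrier G" "a = target G x"
    using assms target_surj by blast
  then show ?thesis
    using target_composable[of x] by (simp add: composable_iff)
qed

lemma target_of_unit:
  assumes "a \<in> unit_set G"
  shows "target G a = a"
proof -
  obtain x where "x \<in> carrier G" "a = source G x"
    using assms source_surj by blast
  then show ?thesis
    using source_composable[of x] by (simp add: composable_iff)
qed

text \<open>
  Associativity includes the claim that \<open>z(xy)\<close> is defined as soon as \<open>zx\<close> and \<open>xy\<close> are. With the
  source of \<open>x\<close> for \<open>z\<close>, this yields the source of \<open>xy\<close>; the target is found in the same way.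
\<close>

lemma source_pmult:
  assumes xy: "(x, y) \<in> composable G"
  shows "source G (pmult G x y) = source G x"
proof -
  have x: "x \<in> carrier G" "y \<in> carrier G"
    using xy by (simp_all add: composable_iff)
  have s: "(source G x, x) \<in> composable G"
    by (rule source_composable[OF x(1)])
  then have "(source G x, pmult G x y) \<in> composable G"
    using assoc_right_defined[of "source G x" x y] x xy by (simp add: composable_iff)
  with s show ?thesis
    by (simp add: composable_iff)
qed

lemma target_pmult:
  assumes xy: "(x, y) \<in> composable G"
  shows "target G (pmult G x y) = target G y"
proof -
  have x: "x \<in> carrier G" "y \<in> carrier G"
    using xy by (simp_all add: composable_iff)
  have s: "(y, target G y) \<in> composable G"
    by (rule target_composable[OF x(2)])
  then have "(pmult G x y, target G y) \<in> composable G"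
    using assoc_left_defined[of x y "target G y"] x xy by (simp add: composable_iff)
  with s show ?thesis
    by (simp add: composable_iff)
qed

lemma source_ginv: "x \<in> carrier G \<Longrightarrow> source G (ginv G x) = target G x"
  using ginv_composable_right by (simp add: composable_iff)

lemma target_ginv: "x \<in> carrier G \<Longrightarrow> target G (ginv G x) = source G x"
  using ginv_composable_left by (simp add: composable_iff)

lemma group_isotropy_group:
  assumes a: "a \<in> unit_set G"
  shows "group (isotropy_group G a)"
proof (rule groupI, goal_cases)
  case (1 x y)
  then show ?case
    using pmult_closed source_pmult target_pmult by (simp add: isotropy_group_simps composable_iff)
next
  case 2
  then show ?case
    using a units_subset by (auto simp: isotropy_group_simps source_of_unit target_of_unit)
next
  case (3 x y z)
  then show ?case
    using assoc by (simp add: isotropy_group_simps composable_iff)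
next
  case (4 x)
  then show ?case
    using source_unit by (auto simp: isotropy_group_simps)
next
  case (5 x)
  then have "ginv G x \<in> carrier (isotropy_group G a)"
    by (simp add: isotropy_group_simps ginv_closed source_ginv target_ginv)
  moreover have "pmult G (ginv G x) x = a"
    using 5 ginv_left by (simp add: isotropy_group_simps)
  ultimately show ?case
    by (auto simp: isotropy_group_simps)
qed

lemma card_isotropy_group_pos:
  assumes "finite (carrier G)" "a \<in> unit_set G"
  shows "card (carrier (isotropy_group G a)) > 0"
  using monoid.one_closed[OF group.is_monoid[OF group_isotropy_group[OF assms(2)]]] assms(1)
  by (auto simp: card_gt_0_iff isotropy_group_simps)

section \<open>Groupoids with two units\<close>

lemma carrier_eq_Un_isotropy_groups:
  assumes units: "unit_set G = {a, b}"
    and loops: "\<And>x. x \<in> carrier G \<Longrightarrow> source G x = target G x"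
  shows "carrier G = carrier (isotropy_group G a) \<union> carrier (isotropy_group G b)"
  using target_in_units loops by (auto simp: isotropy_group_simps units)

text \<open>
  Two loops are composable precisely when they sit at the same unit, as in a coproduct of groups;
  hence isomorphisms of the isotropy groups can be glued without further conditions.
\<close>

lemma isomorphic_group_coproduct:
  assumes units: "unit_set G = {a, b}" and ab: "a \<noteq> b"
    and loops: "\<And>x. x \<in> carrier G \<Longrightarrow> source G x = target G x"
    and isos: "isotropy_group G a \<cong> H" "isotropy_group G b \<cong> K"
  shows "groupoid_isomorphic G (group_coproduct H K)"
proof -
  let ?A = "isotropy_group G a" and ?B = "isotropy_group G b"
  let ?C = "group_coproduct H K"
  obtain f g where "f \<in> iso ?A H" "g \<in> iso ?B K"
    using isos by (auto simp: is_iso_def)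
  then have f: "f \<in> hom ?A H" "bij_betw f (carrier ?A) (carrier H)"
    and g: "g \<in> hom ?B K" "bij_betw g (carrier ?B) (carrier K)"
    by (simp_all add: iso_def)
  define h where "h x = (if source G x = a then Inl (f x) else Inr (g x))" for x
  have hA: "h x = Inl (f x)" if "x \<in> carrier ?A" for x
    using that by (simp add: h_def isotropy_group_simps)
  have hB: "h x = Inr (g x)" if "x \<in> carrier ?B" for x
    using that ab by (auto simp: h_def isotropy_group_simps)
  have carrier: "carrier G = carrier ?A \<union> carrier ?B"
    by (rule carrier_eq_Un_isotropy_groups[OF units loops])
  have carrier_C: "carrier ?C = Inl ` carrier H \<union> Inr ` carrier K"
    by (simp add: group_coproduct_def Plus_def)
  have bij: "bij_betw h (carrier G) (carrier ?C)"
    unfolding carrier carrier_C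
  proof (rule bij_betw_combine)
    have "bij_betw (Inl \<circ> f) (carrier ?A) (Inl ` carrier H)"
      using f(2) by (rule bij_betw_trans) (simp add: bij_betw_def)
    then show "bij_betw h (carrier ?A) (Inl ` carrier H)"
      using hA by (simp cong: bij_betw_cong)
    have "bij_betw (Inr \<circ> g) (carrier ?B) (Inr ` carrier K)"
      using g(2) by (rule bij_betw_trans) (simp add: bij_betw_def)
    then show "bij_betw h (carrier ?B) (Inr ` carrier K)"
      using hB by (simp cong: bij_betw_cong)
  qed auto
  have mult: "(h x, h y) \<in> composable ?C \<and> h (pmult G x y) = pmult ?C (h x) (h y)"
    if xy: "(x, y) \<in> composable G" for x y
  proof -
    have xy': "x \<in> carrier G" "y \<in> carrier G" "target G x = source G y"
      using xy by (simp_all add: composable_iff)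
    moreover have "target G x = a \<or> target G x = b"
      using target_in_units[OF xy'(1)] by (simp add: units)
    ultimately consider "x \<in> carrier ?A" "y \<in> carrier ?A" | "x \<in> carrier ?B" "y \<in> carrier ?B"
      using loops[of x] loops[of y] by (auto simp: isotropy_group_simps)
    then show ?thesis
    proof cases
      case 1
      then have "pmult G x y \<in> carrier ?A"
        using monoid.m_closed[OF group.is_monoid[OF group_isotropy_group[of a]]]
        by (simp add: units isotropy_group_simps)
      moreover have "f (pmult G x y) = f x \<otimes>\<^bsub>H\<^esub> f y" "f x \<in> carrier H" "f y \<in> carrier H"
        using 1 hom_mult[OF f(1)] hom_in_carrier[OF f(1)] by (simp_all add: isotropy_group_simps)
      ultimately show ?thesis
        using 1 hA by (simp add: composable_def group_coproduct_def InlI)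
    next
      case 2
      then have "pmult G x y \<in> carrier ?B"
        using monoid.m_closed[OF group.is_monoid[OF group_isotropy_group[of b]]]
        by (simp add: units isotropy_group_simps)
      moreover have "g (pmult G x y) = g x \<otimes>\<^bsub>K\<^esub> g y" "g x \<in> carrier K" "g y \<in> carrier K"
        using 2 hom_mult[OF g(1)] hom_in_carrier[OF g(1)] by (simp_all add: isotropy_group_simps)
      ultimately show ?thesis
        using 2 hB by (simp add: composable_def group_coproduct_def InrI)
    qed
  qed
  have "h \<in> groupoid_hom G ?C"
    unfolding groupoid_hom_def using mult bij_betw_imp_funcset[OF bij] by blast
  with bij show ?thesis
    unfolding groupoid_isomorphic_def by blast
qed

text \<open>
  With four arrows in all, one of them running between different units, there is exactly one arrow
  for each ordered pair of units. A product is thus determined by its source and target.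
\<close>

lemma isomorphic_saltus_groupoid:
  assumes card: "card (carrier G) = 4"
    and x: "x \<in> carrier G" and neq: "source G x \<noteq> target G x"
  shows "groupoid_isomorphic G saltus_groupoid"
proof -
  define u v y where "u = source G x" and "v = target G x" and "y = ginv G x"
  have units: "u \<in> unit_set G" "v \<in> unit_set G"
    by (simp_all add: u_def v_def x source_in_units target_in_units)
  have mem: "u \<in> carrier G" "v \<in> carrier G" "x \<in> carrier G" "y \<in> carrier G"
    using units units_subset x ginv_closed by (auto simp: y_def)
  have st: "source G u = u" "target G u = u" "source G v = v" "target G v = v"
    "source G x = u" "target G x = v" "source G y = v" "target G y = u"
    using units x
    by (simp_all add: source_of_unit target_of_unit source_ginv target_ginv y_def flip: u_def v_def)
  have uv: "u \<noteq> v"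
    using neq by (simp add: u_def v_def)
  have dist: "distinct [u, v, x, y]"
    using uv st by auto
  then have carrier: "carrier G = {u, v, x, y}"
    using mem card by (intro card_seteq[symmetric]) (auto intro: card_ge_0_finite)
  have pmult: "pmult G u u = u" "pmult G u x = x" "pmult G v v = v" "pmult G v y = y"
    "pmult G x v = x" "pmult G x y = u" "pmult G y u = y" "pmult G y x = v"
    using source_unit[of u] source_unit[of x] source_unit[of v] source_unit[of y]
      target_unit[of x] target_unit[of y] ginv_left[OF x] ginv_right[OF x] mem st
    by (simp_all flip: y_def)
  have comp: "composable G =
      {(u, u), (u, x), (v, v), (v, y), (x, v), (x, y), (y, u), (y, x)}"
    using uv by (auto simp: composable_def carrier st)
  define h where "h z = (if z = u then saltus1 else if z = v then saltus2
    else if z = x then saltus3 else saltus4)" for z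
  have h: "h u = saltus1" "h v = saltus2" "h x = saltus3" "h y = saltus4"
    using dist by (auto simp: h_def)
  have carrier_S: "carrier saltus_groupoid = {saltus1, saltus2, saltus3, saltus4}"
    by (simp add: saltus_groupoid_def)
  have "bij_betw h (carrier G) (carrier saltus_groupoid)"
    using saltus_distinct by (auto simp: bij_betw_def inj_on_def carrier carrier_S h)
  moreover have "h \<in> groupoid_hom G saltus_groupoid"
    by (simp add: groupoid_hom_def comp saltus_composable pmult saltus_pmult h carrier carrier_S)
  ultimately show ?thesis
    by (auto simp: groupoid_isomorphic_def)
qed

end

section \<open>Groupoids of type (4;2)\<close>

theorem theorem2p1:
  fixes G :: "('a, 'm) groupoid_struct_scheme"
  assumes "groupoid_of_type G 4 2"
  shows "groupoid_isomorphic G (group_coproduct (singleton_group ()) (integer_mod_group 3))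
    \<or> groupoid_isomorphic G (group_coproduct (integer_mod_group 2) (integer_mod_group 2))
    \<or> groupoid_isomorphic G saltus_groupoid"
proof -
  interpret groupoid G
    using assms by (simp add: groupoid_of_type_def)
  have fin: "finite (carrier G)" and card: "card (carrier G) = 4" "card (unit_set G) = 2"
    using assms by (simp_all add: groupoid_of_type_def)
  show ?thesis
  proof (cases "\<exists>x\<in>carrier G. source G x \<noteq> target G x")
    case True
    then show ?thesis
      using isomorphic_saltus_groupoid[OF card(1)] by blast
  next
    case False
    then have loops: "source G x = target G x" if "x \<in> carrier G" for x
      using that by blast
    obtain u v where units: "unit_set G = {u, v}" and uv: "u \<noteq> v"
      using card(2) by (auto simp: card_2_iff)
    then have swapped: "unit_set G = {v, u}" "v \<noteq> u"
      by auto
    let ?U = "isotropy_group G u" and ?V = "isotropy_group G v"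
    interpret U: group ?U
      by (rule group_isotropy_group) (simp add: units)
    interpret V: group ?V
      by (rule group_isotropy_group) (simp add: units)
    have carrier: "carrier G = carrier ?U \<union> carrier ?V"
      by (rule carrier_eq_Un_isotropy_groups[OF units loops])
    moreover have "carrier ?U \<inter> carrier ?V = {}"
      using uv by (auto simp: isotropy_group_simps)
    ultimately have "card (carrier ?U) + card (carrier ?V) = 4"
      using card(1) fin by (metis card_Un_disjoint finite_Un)
    moreover have "card (carrier ?U) > 0" "card (carrier ?V) > 0"
      using card_isotropy_group_pos[OF fin] by (simp_all add: units)
    ultimately consider "card (carrier ?U) = 1" "card (carrier ?V) = 3"
      | "card (carrier ?U) = 2" "card (carrier ?V) = 2"
      | "card (carrier ?U) = 3" "card (carrier ?V) = 1"
      by linarith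
    then show ?thesis
    proof cases
      case 1
      then have "?U \<cong> singleton_group ()" "?V \<cong> integer_mod_group 3"
        by (simp_all add: U.order_1_iso_singleton_group V.prime_order_iso_integer_mod_group)
      then show ?thesis
        using isomorphic_group_coproduct[OF units uv loops] by blast
    next
      case 2
      then have "?U \<cong> integer_mod_group 2" "?V \<cong> integer_mod_group 2"
        by (simp_all add: U.prime_order_iso_integer_mod_group V.prime_order_iso_integer_mod_group)
      then show ?thesis
        using isomorphic_group_coproduct[OF units uv loops] by blast
    next
      case 3
      then have "?V \<cong> singleton_group ()" "?U \<cong> integer_mod_group 3"
        by (simp_all add: V.order_1_iso_singleton_group U.prime_order_iso_integer_mod_group)
      then show ?thesis
        using isomorphic_group_coproduct[OF swapped loops] by blast
    qed
  qed
qed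

end
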